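(* Let $p$ be a positive integer, let $\Lambda_0>1$ and $\Lambda_1,\dots,\Lambda_{p-1}\ge 0$. Let $$F(z)=\sum_{k=0}^{p-1}\bar z^{k}A_k(z)$$ be a poly-analytic function of order $p$ in $U$, where all $A_k$ are analytic in $U$ and satisfy $A_k(0)=0$ for $k\in\{0,\dots,p-1\}$, $A_0'(0)=1$, $|A_0'(z)|<\Lambda_0$ for all $z\in U$, and $|A_k'(z)|\le\Lambda_k$ for all $z\in U$ and $k\in\{1,\dots,p-1\}$. Then $F$ is univalent in $U_{\rho_1}$ and $F(U_{\rho_1})$ contains the schlicht disk $U_{\sigma_1}$, where $\rho_1$ is the unique root in $(0,1)$ of the equation $$\Lambda_0\frac{1-\Lambda_0 r}{\Lambda_0-r}-\sum_{k=1}^{p-1}(k+1)\Lambda_k r^k=0,$$ and $$\sigma_1=\Lambda_0^2\rho_1-\sum_{k=1}^{p-1}\Lambda_k\rho_1^{k+1}+(\Lambda_0^3-\Lambda_0)\ln\Big(1-\frac{\rho_1}{\Lambda_0}\Big).$$ This result is sharp, with an extremal function given by $$F_1(z)=\Lambda_0\int_{[0,z]}\frac{\frac1{\Lambda_0}-\zeta}{1-\frac{\zeta}{\Lambda_0}}\,d\zeta-\sum_{k=1}^{p-1}\Lambda_k\bar z^k z=\Lambda_0^2z-\sum_{k=1}^{p-1}\Lambda_k\bar z^kz+(\Lambda_0^3-\Lambda_0)\ln\Big(1-\frac z{\Lambda_0}\Big);$$ that is, $F_1$ satisfies all the hypotheses above, $F_1$ is not univalent in $U_r$ for any $r\in(\rho_1,1]$,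 and $F_1(U_{\rho_1})$ contains no disk $U_R$ with $R>\sigma_1$.
   Context: For $r>0$, $U_r=\{z\in\mathbb C:|z|<r\}$ and $U=U_1$. A continuous function $F:D\to\mathbb C$ on a domain $D\subset\mathbb C$ is poly-analytic of order $p$ if $\partial^pF/\partial\bar z^p=0$ in $D$; in a simply connected domain this is equivalent to $F=\sum_{k=0}^{p-1}\bar z^kA_k(z)$ with all $A_k$ analytic. Univalent means injective. A schlicht disk in $F(U_\rho)$ is a disk that is the univalent image under $F$ of some region in $U_\rho$. Empty sums (when $p=1$) are $0$. $[0,z]$ is the line segment from $0$ to $z$, and $\ln$ is the principal logarithm. *)

theory Defs
  imports "HOL-Complex_Analysis.Complex_Analysis"
begin

definition dbar :: "(complex \<Rightarrow> complex) \<Rightarrow> complex \<Rightarrow> complex" where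
  "dbar F z = (frechet_derivative F (at z) 1 + \<i> * frechet_derivative F (at z) \<i>) / 2"

text \<open>
  The Frechet derivative in \<^const>\<open>dbar\<close> is the real one, and it is unspecified at points of
  non-differentiability; so the existence of the derivatives up to order \<open>p\<close> is part of the
  definition below.
\<close>

definition polyanalytic_on :: "nat \<Rightarrow> (complex \<Rightarrow> complex) \<Rightarrow> complex set \<Rightarrow> bool" where
  "polyanalytic_on p F D \<longleftrightarrow>
     continuous_on D F \<and>
     (\<forall>j<p. \<forall>z\<in>D. (dbar ^^ j) F differentiable (at z)) \<and>
     (\<forall>z\<in>D. (dbar ^^ p) F z = 0)"

definition landau_hyps ::
    "nat \<Rightarrow> (nat \<Rightarrow> real) \<Rightarrow> (nat \<Rightarrow> complex \<Rightarrow> complex) \<Rightarrow> (complex \<Rightarrow> complex) \<Rightarrow> bool" where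
  "landau_hyps p \<Lambda> A F \<longleftrightarrow>
     polyanalytic_on p F (ball 0 1) \<and>
     (\<forall>k<p. A k analytic_on ball 0 1) \<and>
     (\<forall>z\<in>ball 0 1. F z = (\<Sum>k<p. cnj z ^ k * A k z)) \<and>
     (\<forall>k<p. A k 0 = 0) \<and>
     deriv (A 0) 0 = 1 \<and>
     (\<forall>z\<in>ball 0 1. norm (deriv (A 0) z) < \<Lambda> 0) \<and>
     (\<forall>k\<in>{1..<p}. \<forall>z\<in>ball 0 1. norm (deriv (A k) z) \<le> \<Lambda> k)"

definition contains_schlicht_disk ::
    "(complex \<Rightarrow> complex) \<Rightarrow> real \<Rightarrow> complex \<Rightarrow> real \<Rightarrow> bool" where
  "contains_schlicht_disk F \<rho> c R \<longleftrightarrow>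
     R > 0 \<and>
     (\<exists>\<Omega>. open \<Omega> \<and> connected \<Omega> \<and> \<Omega> \<noteq> {} \<and> \<Omega> \<subseteq> ball 0 \<rho> \<and>
          inj_on F \<Omega> \<and> F ` \<Omega> = ball c R)"

definition is_radius_root :: "nat \<Rightarrow> (nat \<Rightarrow> real) \<Rightarrow> real \<Rightarrow> bool" where
  "is_radius_root p \<Lambda> r \<longleftrightarrow>
     0 < r \<and> r < 1 \<and>
     \<Lambda> 0 * ((1 - \<Lambda> 0 * r) / (\<Lambda> 0 - r)) - (\<Sum>k\<in>{1..<p}. real (k + 1) * \<Lambda> k * r ^ k) = 0"

definition landau_sigma :: "nat \<Rightarrow> (nat \<Rightarrow> real) \<Rightarrow> real \<Rightarrow> real" where
  "landau_sigma p \<Lambda> r =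
     (\<Lambda> 0)\<^sup>2 * r - (\<Sum>k\<in>{1..<p}. \<Lambda> k * r ^ (k + 1)) + ((\<Lambda> 0) ^ 3 - \<Lambda> 0) * ln (1 - r / \<Lambda> 0)"

definition extremal_fun :: "nat \<Rightarrow> (nat \<Rightarrow> real) \<Rightarrow> complex \<Rightarrow> complex" where
  "extremal_fun p \<Lambda> z =
     of_real (\<Lambda> 0) * contour_integral (linepath 0 z)
       (\<lambda>\<zeta>. (1 / of_real (\<Lambda> 0) - \<zeta>) / (1 - \<zeta> / of_real (\<Lambda> 0)))
     - (\<Sum>k\<in>{1..<p}. of_real (\<Lambda> k) * cnj z ^ k * z)"

end

theory Submission
  imports Defs
begin

text \<open>
  Schwarz--Pick for \<open>A\<^sub>0' / \<Lambda>\<^sub>0\<close> puts its values in a disk symmetric about the real axis, whose leftmost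
  point gives \<open>Re (A\<^sub>0' z) \<ge> \<Lambda>\<^sub>0 (1 - \<Lambda>\<^sub>0 r) / (\<Lambda>\<^sub>0 - r)\<close> with \<open>r = \<bar>z\<bar>\<close>. The other terms change the
  derivative of \<open>F\<close> in a unit direction \<open>u\<close> by at most \<open>\<Sum>(k + 1) \<Lambda>\<^sub>k r\<^sup>k\<close>, so the derivative has a component
  along \<open>u\<close> of at least \<open>radius_fun r\<close>, which is positive for \<open>r < \<rho>\<^sub>1\<close> and is the derivative of \<open>landau_sigma\<close>.
  Hence \<open>Re (cnj u * F)\<close> increases strictly along segments of direction \<open>u\<close> in the closed disk of
  radius \<open>\<rho>\<^sub>1\<close>, and \<open>\<bar>F z\<bar> \<ge> landau_sigma \<bar>z\<bar>\<close>. On the positive real axis the extremal function is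
  \<open>landau_sigma\<close> itself, which turns around at \<open>\<rho>\<^sub>1\<close>; since injectivity holds up to the boundary, it takes the
  value \<open>\<sigma>\<^sub>1\<close> at \<open>\<rho>\<^sub>1\<close> and not in the open disk.
\<close>

section \<open>Schwarz-Pick lower bound for the real part\<close>

text \<open>The map \<open>\<omega>\<close> = f / M sends the unit disk into itself and 0 to
  \<open>a\<close> = 1 / M. Following it by the disk automorphism that takes \<open>a\<close> to 0
  gives \<open>\<psi>\<close>, to which the Schwarz lemma applies; the estimate is then solved for
  the real part of \<open>\<omega> z\<close>.\<close>

lemma Re_ge_of_norm_less:
  assumes hol: "f holomorphic_on ball 0 1" and f0: "f 0 = 1"
    and bound: "\<And>z. norm z < 1 \<Longrightarrow> norm (f z) < M" and z: "norm z < 1"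
  shows "M * ((1 - M * norm z) / (M - norm z)) \<le> Re (f z)"
proof -
  have M: "M > 1" using bound[of 0] f0 by simp
  define a where "a = 1 / M"
  have a: "0 < a" "a < 1" using M by (auto simp: a_def)
  define \<omega> where "\<omega> = (\<lambda>z. f z / of_real M)"
  have \<omega>1: "norm (\<omega> w) < 1" if "norm w < 1" for w
    using bound[OF that] M by (simp add: \<omega>_def norm_divide)
  define \<psi> where "\<psi> = Moebius_function 0 (of_real a) \<circ> \<omega>"
  have na: "norm (complex_of_real a) < 1" using a by simp
  have "\<psi> holomorphic_on ball 0 1"
    unfolding \<psi>_def
  proof (rule holomorphic_on_compose_gen[OF _ Moebius_function_holomorphic[OF na]])
    show "\<omega> holomorphic_on ball 0 1"
      unfolding \<omega>_def using M by (intro holomorphic_intros hol) auto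
    show "\<omega> ` ball 0 1 \<subseteq> ball 0 1" using \<omega>1 by auto
  qed
  moreover have "\<psi> 0 = 0" by (simp add: \<psi>_def \<omega>_def f0 a_def Moebius_function_simple)
  moreover have "norm (\<psi> w) < 1" if "norm w < 1" for w
    using Moebius_function_norm_lt_1[OF na \<omega>1[OF that]] by (simp add: \<psi>_def)
  ultimately have S: "norm (\<psi> z) \<le> norm z" using Schwarz_Lemma(1)[of \<psi> z] z by blast
  define r where "r = norm z"
  have r: "0 \<le> r" "r < 1" using z by (auto simp: r_def)
  define x y where "x = Re (\<omega> z)" and "y = Im (\<omega> z)"
  have x1: "x < 1" using \<omega>1[OF z] complex_Re_le_cmod[of "\<omega> z"] by (simp add: x_def)
  have ax: "0 < 1 - a * x"
  proof -
    have "a * x < 1"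
      using a x1 by (smt (verit) mult_left_le mult_pos_neg mult_strict_mono mult_nonneg_nonpos)
    then show ?thesis by simp
  qed
  have ne: "1 - complex_of_real a * \<omega> z \<noteq> 0"
  proof
    assume "1 - complex_of_real a * \<omega> z = 0"
    then have "Re (1 - complex_of_real a * \<omega> z) = 0" by simp
    then show False using ax by (simp add: x_def)
  qed
  have "norm (\<omega> z - a) \<le> r * norm (1 - a * \<omega> z)"
    using S ne by (simp add: \<psi>_def Moebius_function_simple norm_divide field_simps r_def)
  then have "(norm (\<omega> z - a))\<^sup>2 \<le> (r * norm (1 - a * \<omega> z))\<^sup>2"
    by (intro power_mono) auto
  then have "(x - a)\<^sup>2 + y\<^sup>2 \<le> r\<^sup>2 * ((1 - a * x)\<^sup>2 + (a * y)\<^sup>2)"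
    by (simp add: power_mult_distrib cmod_power2 x_def y_def)
  \<comment> \<open>The imaginary part enters the right-hand side with a coefficient of at most 1,
    so it can be cancelled, which leaves an inequality in \<open>x\<close> alone.\<close>
  moreover have "r\<^sup>2 * a\<^sup>2 * y\<^sup>2 \<le> y\<^sup>2"
  proof -
    have "r\<^sup>2 * a\<^sup>2 \<le> 1"
      using r a by (metis abs_square_le_1 abs_of_nonneg less_imp_le mult_le_one power_mult_distrib mult_nonneg_nonneg)
    then show ?thesis using mult_right_mono[of "r\<^sup>2 * a\<^sup>2" 1 "y\<^sup>2"] by simp
  qed
  ultimately have "(x - a)\<^sup>2 \<le> (r * (1 - a * x))\<^sup>2"
    by (simp add: distrib_left power_mult_distrib mult.assoc)
  then have "\<bar>x - a\<bar> \<le> r * (1 - a * x)"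
    using r ax by (metis abs_le_square_iff abs_of_nonneg less_imp_le mult_nonneg_nonneg)
  then have "a - r \<le> x * (1 - a * r)" by (simp add: algebra_simps abs_le_iff)
  moreover have "x = Re (f z) * a" by (simp add: x_def \<omega>_def a_def)
  ultimately have "1 / M - r \<le> Re (f z) / M * (1 - r / M)" by (simp add: a_def)
  then have "M * M * (1 / M - r) \<le> M * M * (Re (f z) / M * (1 - r / M))"
    using M by (intro mult_left_mono) auto
  then have "M * (1 - M * r) \<le> Re (f z) * (M - r)"
  proof -
    have "M * M * (1 / M - r) = M * (1 - M * r)"
      and "M * M * (Re (f z) / M * (1 - r / M)) = Re (f z) * (M - r)"
      using M by (simp_all add: field_simps)
    then show ?thesis using \<open>M * M * (1 / M - r) \<le> _\<close> by (simp only:)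
  qed
  then show ?thesis using M r by (simp add: field_simps r_def)
qed

section \<open>The radius equation and the antiderivative of its left-hand side\<close>

definition radius_fun :: "nat \<Rightarrow> (nat \<Rightarrow> real) \<Rightarrow> real \<Rightarrow> real" where
  "radius_fun p \<Lambda> r =
     \<Lambda> 0 * ((1 - \<Lambda> 0 * r) / (\<Lambda> 0 - r)) - (\<Sum>k\<in>{1..<p}. real (k + 1) * \<Lambda> k * r ^ k)"

lemma is_radius_root_iff: "is_radius_root p \<Lambda> r \<longleftrightarrow> 0 < r \<and> r < 1 \<and> radius_fun p \<Lambda> r = 0"
  by (simp add: is_radius_root_def radius_fun_def)

lemma radius_fun_strict_antimono:
  assumes "\<Lambda> 0 > 1" and "\<forall>k\<in>{1..<p}. \<Lambda> k \<ge> 0" and "0 \<le> r" "r < s" "s \<le> 1"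
  shows "radius_fun p \<Lambda> s < radius_fun p \<Lambda> r"
proof -
  have "(\<Sum>k\<in>{1..<p}. real (k + 1) * \<Lambda> k * r ^ k) \<le> (\<Sum>k\<in>{1..<p}. real (k + 1) * \<Lambda> k * s ^ k)"
    using assms by (intro sum_mono mult_left_mono power_mono) auto
  moreover have "(1 - \<Lambda> 0 * s) / (\<Lambda> 0 - s) < (1 - \<Lambda> 0 * r) / (\<Lambda> 0 - r)"
  proof -
    \<comment> \<open>This product is the numerator of the difference of the two fractions.\<close>
    have "0 < (\<Lambda> 0 * \<Lambda> 0 - 1) * (s - r)" using assms by (simp add: less_1_mult)
    then show ?thesis using assms by (simp add: field_simps)
  qed
  then have "\<Lambda> 0 * ((1 - \<Lambda> 0 * s) / (\<Lambda> 0 - s)) < \<Lambda> 0 * ((1 - \<Lambda> 0 * r) / (\<Lambda> 0 - r))"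
    using assms(1) by (intro mult_strict_left_mono) auto
  ultimately show ?thesis unfolding radius_fun_def by linarith
qed

text \<open>The function is 1 at 0 and at most \<open>- \<Lambda> 0\<close> at 1, so the
  intermediate value theorem yields a root; strict monotonicity makes it unique.\<close>

lemma ex1_radius_root:
  assumes "\<Lambda> 0 > 1" and "\<forall>k\<in>{1..<p}. \<Lambda> k \<ge> 0"
  shows "\<exists>!r. is_radius_root p \<Lambda> r"
proof -
  have cont: "continuous_on {0..1} (radius_fun p \<Lambda>)"
    unfolding radius_fun_def using assms(1) by (intro continuous_intros) auto
  have r0: "radius_fun p \<Lambda> 0 = 1" using assms(1) by (simp add: radius_fun_def)
  have "0 \<le> (\<Sum>k\<in>{1..<p}. real (k + 1) * \<Lambda> k)" using assms(2) by (intro sum_nonneg) auto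
  moreover have "(1 - \<Lambda> 0) / (\<Lambda> 0 - 1) = -1" using assms(1) by (simp add: field_simps)
  ultimately have r1: "radius_fun p \<Lambda> 1 < 0" using assms(1) by (simp add: radius_fun_def)
  obtain r where r: "0 \<le> r" "r \<le> 1" "radius_fun p \<Lambda> r = 0"
    using IVT2'[of "radius_fun p \<Lambda>" 1 0 0] r0 r1 cont by auto
  then have "r \<noteq> 0" "r \<noteq> 1" using r0 r1 by auto
  then have "is_radius_root p \<Lambda> r" using r by (simp add: is_radius_root_iff)
  moreover have "s = r" if "is_radius_root p \<Lambda> s" for s
    using that \<open>is_radius_root p \<Lambda> r\<close> radius_fun_strict_antimono[of \<Lambda> p r s]
      radius_fun_strict_antimono[of \<Lambda> p s r] assms
    unfolding is_radius_root_iff by (smt (verit))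
  ultimately show ?thesis by blast
qed

lemma landau_sigma_0: "landau_sigma p \<Lambda> 0 = 0"
  by (simp add: landau_sigma_def)

text \<open>The condition r < 1 < \<open>\<Lambda> 0\<close> keeps the logarithm's argument
  positive. Negative r are included, so the derivative at 0 is two-sided.\<close>

lemma landau_sigma_derivative:
  assumes "\<Lambda> 0 > 1" "r < 1"
  shows "(landau_sigma p \<Lambda> has_real_derivative radius_fun p \<Lambda> r) (at r)"
proof -
  let ?L = "\<Lambda> 0"
  have pos: "1 - r / ?L > 0" using assms by (simp add: field_simps)
  have "(landau_sigma p \<Lambda> has_real_derivative
      ?L\<^sup>2 - (\<Sum>k\<in>{1..<p}. \<Lambda> k * (real (k + 1) * r ^ k)) + (?L ^ 3 - ?L) * (- (1 / ?L) / (1 - r / ?L))) (at r)"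
    unfolding landau_sigma_def
  proof (intro DERIV_add DERIV_diff DERIV_sum DERIV_cmult)
    show "((\<lambda>r. ?L\<^sup>2 * r) has_real_derivative ?L\<^sup>2) (at r)"
      by (auto intro!: derivative_eq_intros)
    show "((\<lambda>r. r ^ (k + 1)) has_real_derivative real (k + 1) * r ^ k) (at r)" for k
      using DERIV_pow[of "k + 1" r] by simp
    show "((\<lambda>r. ln (1 - r / ?L)) has_real_derivative - (1 / ?L) / (1 - r / ?L)) (at r)"
      using pos assms(1) by (auto intro!: derivative_eq_intros)
  qed
  moreover have "?L\<^sup>2 + (?L ^ 3 - ?L) * (- (1 / ?L) / (1 - r / ?L)) = ?L * ((1 - ?L * r) / (?L - r))"
    using assms by (simp add: field_simps power2_eq_square power3_eq_cube)
  ultimately have "(landau_sigma p \<Lambda> has_real_derivative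
      ?L * ((1 - ?L * r) / (?L - r)) - (\<Sum>k\<in>{1..<p}. \<Lambda> k * (real (k + 1) * r ^ k))) (at r)"
    by (elim DERIV_cong) linarith
  then show ?thesis
    by (simp add: radius_fun_def ac_simps)
qed

section \<open>Wirtinger derivatives of polyanalytic sums\<close>

text \<open>Product rule in Wirtinger form: the coefficients of \<open>h\<close> and
  \<open>cnj h\<close> are the derivatives with respect to z and its conjugate. At k = 0 the
  truncated exponent \<open>k - 1\<close> is harmless, since the factor \<open>of_nat k\<close>
  vanishes.\<close>

lemma has_derivative_cnj_power_mult:
  assumes "(A has_field_derivative A') (at z)"
  shows "((\<lambda>z. cnj z ^ k * A z) has_derivative
           (\<lambda>h. cnj z ^ k * A' * h + of_nat k * cnj z ^ (k - 1) * A z * cnj h)) (at z)"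
proof -
  have A: "(A has_derivative (*) A') (at z)"
    using assms by (simp add: has_field_derivative_def)
  have c: "(cnj has_derivative cnj) (at z)"
    by (rule bounded_linear.has_derivative[OF bounded_linear_cnj has_derivative_ident])
  show ?thesis
    by (rule has_derivative_eq_rhs[OF has_derivative_mult[OF has_derivative_power[OF c] A]])
       (auto simp: algebra_simps fun_eq_iff)
qed

text \<open>The differential takes the values a + b at 1 and i (a - b) at i, so the combination
  defining \<open>dbar\<close> isolates b.\<close>

lemma dbar_eqI:
  assumes "(F has_derivative (\<lambda>h. a * h + b * cnj h)) (at z)"
  shows "dbar F z = b"
  unfolding dbar_def frechet_derivative_at[OF assms, symmetric]
  by (simp add: algebra_simps flip: mult.assoc)

lemma has_derivative_polyanalytic_sum:
  assumes "open S" "\<And>k. k < p \<Longrightarrow> A k holomorphic_on S"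
    and "\<And>z. z \<in> S \<Longrightarrow> F z = (\<Sum>k<p. cnj z ^ k * A k z)" and "z \<in> S"
  shows "(F has_derivative (\<lambda>h. (\<Sum>k<p. cnj z ^ k * deriv (A k) z) * h
           + (\<Sum>k<p. of_nat k * cnj z ^ (k - 1) * A k z) * cnj h)) (at z)"
proof -
  have "((\<lambda>z. \<Sum>k<p. cnj z ^ k * A k z) has_derivative
          (\<lambda>h. \<Sum>k<p. cnj z ^ k * deriv (A k) z * h + of_nat k * cnj z ^ (k - 1) * A k z * cnj h)) (at z)"
    using assms by (intro has_derivative_sum has_derivative_cnj_power_mult holomorphic_derivI[of _ S]) auto
  then have "((\<lambda>z. \<Sum>k<p. cnj z ^ k * A k z) has_derivative
      (\<lambda>h. (\<Sum>k<p. cnj z ^ k * deriv (A k) z) * h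
           + (\<Sum>k<p. of_nat k * cnj z ^ (k - 1) * A k z) * cnj h)) (at z)"
    by (simp add: sum.distrib sum_distrib_right)
  then show ?thesis
    by (rule has_derivative_transform_within_open[OF _ assms(1,4)]) (simp add: assms(3))
qed

text \<open>Induction on the order: \<open>dbar\<close> lowers every power of \<open>cnj z\<close>
  by one. The induction runs over all coefficients and functions because its hypothesis is applied
  to \<open>dbar F\<close>, which is known as a sum only on \<open>S\<close>.\<close>

lemma polyanalytic_on_sum:
  assumes "open S" "\<And>k. k < p \<Longrightarrow> A k holomorphic_on S"
    and "\<And>z. z \<in> S \<Longrightarrow> F z = (\<Sum>k<p. cnj z ^ k * A k z)"
  shows "polyanalytic_on p F S"
  using assms(2,3)
proof (induction p arbitrary: A F)
  case 0
  then show ?case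
    by (auto simp: polyanalytic_on_def cong: continuous_on_cong)
next
  case (Suc p)
  note der = has_derivative_polyanalytic_sum[OF assms(1) Suc.prems]
  have diff: "F differentiable (at z)" if "z \<in> S" for z
    using der[OF _ _ that] by (auto simp: differentiable_def)
  \<comment> \<open>The term k = 0 is analytic and drops out; shifting the index leaves a sum of
    length \<open>p\<close>.\<close>
  have "dbar F z = (\<Sum>k<p. cnj z ^ k * (of_nat (Suc k) * A (Suc k) z))" if "z \<in> S" for z
    using dbar_eqI[OF der[OF _ _ that]]
    by (simp add: sum.lessThan_Suc_shift algebra_simps del: sum.lessThan_Suc)
  then have "polyanalytic_on p (dbar F) S"
    by (intro Suc.IH[of "\<lambda>k z. of_nat (Suc k) * A (Suc k) z"])
       (auto intro!: holomorphic_intros Suc.prems simp del: of_nat_Suc)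
  moreover have "(\<forall>j<Suc p. \<forall>z\<in>S. (dbar ^^ j) F differentiable at z) \<longleftrightarrow>
     (\<forall>z\<in>S. F differentiable at z) \<and> (\<forall>j<p. \<forall>z\<in>S. (dbar ^^ Suc j) F differentiable at z)"
    by (simp add: All_less_Suc2)
  moreover have "continuous_on S F"
    using diff by (meson continuous_at_imp_continuous_on differentiable_imp_continuous_within)
  ultimately show ?case
    using diff by (simp add: polyanalytic_on_def funpow_Suc_right del: funpow.simps)
qed

section \<open>Directional derivatives under the Landau hypotheses\<close>

lemma landau_hypsD:
  assumes "landau_hyps p \<Lambda> A F"
  shows "\<And>k. k < p \<Longrightarrow> A k holomorphic_on ball 0 1"
    and "\<And>z. norm z < 1 \<Longrightarrow> F z = (\<Sum>k<p. cnj z ^ k * A k z)"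
    and "\<And>k. k < p \<Longrightarrow> A k 0 = 0"
    and "deriv (A 0) 0 = 1"
    and "\<And>z. norm z < 1 \<Longrightarrow> norm (deriv (A 0) z) < \<Lambda> 0"
    and "\<And>k z. k \<in> {1..<p} \<Longrightarrow> norm z < 1 \<Longrightarrow> norm (deriv (A k) z) \<le> \<Lambda> k"
  using assms by (auto simp: landau_hyps_def analytic_imp_holomorphic)

text \<open>Mean value inequality on the convex unit disk, starting from
  \<open>A k 0 = 0\<close>.\<close>

lemma landau_coeff_le:
  assumes "landau_hyps p \<Lambda> A F" "k \<in> {1..<p}" "norm z < 1"
  shows "norm (A k z) \<le> \<Lambda> k * norm z"
proof -
  note D = landau_hypsD[OF assms(1)]
  have "norm (A k z - A k 0) \<le> \<Lambda> k * norm (z - 0)"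
  proof (rule field_differentiable_bound[of "ball 0 1"])
    show "(A k has_field_derivative deriv (A k) w) (at w within ball 0 1)"
      if "w \<in> ball 0 1" for w
      using that assms(2) by (intro has_field_derivative_at_within[OF holomorphic_derivI[OF D(1)]]) auto
  qed (use assms D(6) in auto)
  then show ?thesis using D(3) assms(2) by simp
qed

text \<open>Multiplication by \<open>cnj u\<close> leaves the z-derivative unchanged, as |u| = 1,
  and gives the conjugate derivative the unimodular factor \<open>(cnj u)\<^sup>2\<close>. Thus only
  moduli matter for k \<ge> 1, while the term k = 0 is exactly \<open>deriv (A 0) z\<close>.\<close>

lemma landau_derivative:
  assumes p: "p \<ge> 1" and hyps: "landau_hyps p \<Lambda> A F" and z: "norm z < 1" and u: "norm u = 1"
  shows "\<exists>D. (F has_derivative D) (at z) \<and> radius_fun p \<Lambda> (norm z) \<le> Re (cnj u * D u)"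
proof (intro exI conjI)
  note D = landau_hypsD[OF hyps]
  let ?D = "\<lambda>h. (\<Sum>k<p. cnj z ^ k * deriv (A k) z) * h
           + (\<Sum>k<p. of_nat k * cnj z ^ (k - 1) * A k z) * cnj h"
  show "(F has_derivative ?D) (at z)"
    by (rule has_derivative_polyanalytic_sum[of "ball 0 1"]) (use D z in auto)
  have uu: "cnj u * u = 1"
    using u by (metis complex_norm_square mult.commute of_real_1 one_power2)
  have split: "{..<p} = insert 0 {1..<p}" using p by auto
  let ?T = "\<lambda>k. cnj z ^ k * deriv (A k) z + of_nat k * cnj z ^ (k - 1) * A k z * (cnj u)\<^sup>2"
  have "cnj u * ?D u = (\<Sum>k<p. cnj z ^ k * deriv (A k) z) * (cnj u * u)
      + (\<Sum>k<p. of_nat k * cnj z ^ (k - 1) * A k z) * (cnj u)\<^sup>2"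
    by (simp add: algebra_simps power2_eq_square)
  also have "\<dots> = (\<Sum>k<p. ?T k)"
    by (simp add: uu sum.distrib sum_distrib_right)
  also have "\<dots> = deriv (A 0) z + (\<Sum>k\<in>{1..<p}. ?T k)"
    unfolding split by (subst sum.insert) auto
  finally have eq: "Re (cnj u * ?D u) = Re (deriv (A 0) z) + Re (\<Sum>k\<in>{1..<p}. ?T k)"
    by simp
  have "norm (?T k) \<le> real (k + 1) * \<Lambda> k * norm z ^ k" if k: "k \<in> {1..<p}" for k
  proof -
    have "norm (?T k) \<le> norm z ^ k * norm (deriv (A k) z) + real k * norm z ^ (k - 1) * norm (A k z)"
      by (rule order_trans[OF norm_triangle_ineq]) (simp add: norm_mult norm_power u)
    also have "\<dots> \<le> norm z ^ k * \<Lambda> k + real k * norm z ^ (k - 1) * (\<Lambda> k * norm z)"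
      using D(6)[OF k z] landau_coeff_le[OF hyps k z]
      by (intro add_mono mult_left_mono) auto
    also have "\<dots> = real (k + 1) * \<Lambda> k * norm z ^ k"
      using k by (cases k) (auto simp: algebra_simps)
    finally show ?thesis .
  qed
  then have "norm (\<Sum>k\<in>{1..<p}. ?T k) \<le> (\<Sum>k\<in>{1..<p}. real (k + 1) * \<Lambda> k * norm z ^ k)"
    by (intro order_trans[OF norm_sum] sum_mono)
  moreover have "\<Lambda> 0 * ((1 - \<Lambda> 0 * norm z) / (\<Lambda> 0 - norm z)) \<le> Re (deriv (A 0) z)"
    using p by (intro Re_ge_of_norm_less holomorphic_deriv) (auto intro: D z)
  ultimately show "radius_fun p \<Lambda> (norm z) \<le> Re (cnj u * ?D u)"
    unfolding eq radius_fun_def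
    using abs_Re_le_cmod[of "\<Sum>k\<in>{1..<p}. ?T k"] by linarith
qed

lemma landau_ray_derivative:
  assumes "p \<ge> 1" "landau_hyps p \<Lambda> A F" "norm (a + of_real t * u) < 1" "norm u = 1"
  shows "\<exists>y. ((\<lambda>t. Re (cnj u * F (a + of_real t * u))) has_real_derivative y) (at t)
           \<and> radius_fun p \<Lambda> (norm (a + of_real t * u)) \<le> y"
proof -
  obtain D where D: "(F has_derivative D) (at (a + of_real t * u))"
    and le: "radius_fun p \<Lambda> (norm (a + of_real t * u)) \<le> Re (cnj u * D u)"
    using landau_derivative[OF assms] by blast
  have "((\<lambda>t. a + of_real t * u) has_derivative (\<lambda>h. of_real h * u)) (at t)"
    by (auto intro!: derivative_eq_intros)
  from has_derivative_compose[OF this D]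
  have "((\<lambda>t. Re (cnj u * F (a + of_real t * u))) has_derivative (\<lambda>h. Re (cnj u * D (of_real h * u)))) (at t)"
    by (intro derivative_intros)
  moreover have "D (of_real h * u) = of_real h * D u" for h
    using linear_scale[OF has_derivative_linear[OF D], of h u] by (simp add: scaleR_conv_of_real)
  then have "(\<lambda>h. Re (cnj u * D (of_real h * u))) = (*) (Re (cnj u * D u))"
    by (auto simp: fun_eq_iff algebra_simps)
  ultimately show ?thesis
    using le by (auto simp: has_field_derivative_def)
qed

lemma landau_continuous_on:
  assumes "landau_hyps p \<Lambda> A F"
  shows "continuous_on (ball 0 1) F"
  using assms by (simp add: landau_hyps_def polyanalytic_on_def)

section \<open>Univalence, growth and the schlicht disk\<close>

text \<open>Positivity is assumed only below \<open>\<rho>\<close>, yet injectivity reaches the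
  boundary circle; this is what later excludes the value at \<open>\<rho>\<close> from the image of
  the open disk.\<close>

lemma landau_inj_on_cball:
  assumes p: "p \<ge> 1" and hyps: "landau_hyps p \<Lambda> A F" and "\<rho> < 1"
    and pos: "\<And>r. 0 \<le> r \<Longrightarrow> r < \<rho> \<Longrightarrow> radius_fun p \<Lambda> r > 0"
  shows "inj_on F (cball 0 \<rho>)"
proof (rule inj_onI, rule ccontr)
  fix a b assume ab: "a \<in> cball 0 \<rho>" "b \<in> cball 0 \<rho>" "F a = F b" "a \<noteq> b"
  define l where "l = norm (b - a)"
  define u where "u = (b - a) / of_real l"
  have l: "l > 0" and u: "norm u = 1" using ab by (auto simp: l_def u_def norm_divide)
  have b: "a + of_real l * u = b" using l by (simp add: u_def)
  have closed: "a + of_real t * u \<in> cball 0 \<rho>" if "0 \<le> t" "t \<le> l" for t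
  proof -
    have "a + of_real t * u = (1 - t / l) *\<^sub>R a + (t / l) *\<^sub>R b"
      using l by (simp add: u_def scaleR_conv_of_real field_simps)
    then show ?thesis using ab l that convexD_alt[OF convex_cball[of 0 \<rho>], of a b "t / l"]
      by simp
  qed
  \<comment> \<open>Strict convexity of the disk: even a chord between two boundary points has its
    interior in the open disk, where the derivative is positive.\<close>
  have opened: "norm (a + of_real t * u) < \<rho>" if "0 < t" "t < l" for t
  proof -
    have "a + of_real t * u = (1 - t / l) *\<^sub>R a + (t / l) *\<^sub>R b"
      using l by (simp add: u_def scaleR_conv_of_real field_simps)
    then have "a + of_real t * u \<in> open_segment a b"
      using that l ab unfolding in_segment by (auto intro!: exI[of _ "t / l"])
    from dist_decreases_open_segment[OF this, of 0] show ?thesis using ab by auto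
  qed
  have "Re (cnj u * F (a + of_real 0 * u)) < Re (cnj u * F (a + of_real l * u))"
  proof (rule DERIV_pos_imp_increasing_open[OF l])
    fix t assume t: "0 < t" "t < l"
    obtain y where y: "((\<lambda>t. Re (cnj u * F (a + of_real t * u))) has_real_derivative y) (at t)"
      "radius_fun p \<Lambda> (norm (a + of_real t * u)) \<le> y"
      using landau_ray_derivative[OF p hyps _ u, of a t] opened[OF t] \<open>\<rho> < 1\<close> by auto
    moreover have "y > 0" using y(2) pos[OF norm_ge_zero opened[OF t]] by linarith
    ultimately show "\<exists>y. ((\<lambda>t. Re (cnj u * F (a + of_real t * u))) has_real_derivative y) (at t) \<and> y > 0"
      by blast
  next
    have "continuous_on {0..l} (\<lambda>t. F (a + of_real t * u))"
      by (rule continuous_on_compose2[OF landau_continuous_on[OF hyps]])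
        (use closed \<open>\<rho> < 1\<close> in \<open>auto intro!: continuous_intros simp: dist_norm\<close>, force)
    then show "continuous_on {0..l} (\<lambda>t. Re (cnj u * F (a + of_real t * u)))"
      by (intro continuous_intros)
  qed
  then show False using b ab by simp
qed

text \<open>Along the ray from 0 to z the function Re (\<open>cnj u * F\<close>) grows at least as
  fast as \<open>landau_sigma\<close>, and both start at 0. Only derivatives are compared, so no
  sign of \<open>radius_fun\<close> is involved.\<close>

lemma landau_sigma_le_norm:
  assumes p: "p \<ge> 1" and \<Lambda>0: "\<Lambda> 0 > 1" and hyps: "landau_hyps p \<Lambda> A F" and z: "norm z < 1"
  shows "landau_sigma p \<Lambda> (norm z) \<le> norm (F z)"
proof (cases "z = 0")
  case True
  then show ?thesis by (simp add: landau_sigma_0)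
next
  case False
  define u where "u = sgn z"
  have u: "norm u = 1" using False by (simp add: u_def norm_sgn)
  have zu: "z = of_real (norm z) * u" using False by (simp add: u_def sgn_eq)
  have F0: "F 0 = 0"
    using landau_hypsD(2)[OF hyps, of 0] landau_hypsD(3)[OF hyps] by simp
  let ?f = "\<lambda>t. Re (cnj u * F (0 + of_real t * u)) - landau_sigma p \<Lambda> t"
  have "?f 0 \<le> ?f (norm z)"
  proof (rule DERIV_nonneg_imp_nondecreasing[of 0 "norm z" ?f])
    fix t assume t: "0 \<le> t" "t \<le> norm z"
    then have nt: "norm (0 + of_real t * u) = t" by (simp add: norm_mult u)
    obtain y where "((\<lambda>t. Re (cnj u * F (0 + of_real t * u))) has_real_derivative y) (at t)"
      "radius_fun p \<Lambda> t \<le> y"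
      using landau_ray_derivative[OF p hyps _ u, of 0 t] nt t z by auto
    moreover have "(landau_sigma p \<Lambda> has_real_derivative radius_fun p \<Lambda> t) (at t)"
      using landau_sigma_derivative \<Lambda>0 t z by simp
    ultimately have "(?f has_real_derivative y - radius_fun p \<Lambda> t) (at t)" "y - radius_fun p \<Lambda> t \<ge> 0"
      by (auto intro: DERIV_diff)
    then show "\<exists>y. (?f has_real_derivative y) (at t) \<and> 0 \<le> y" by blast
  qed simp
  then have "landau_sigma p \<Lambda> (norm z) \<le> Re (cnj u * F z)"
    using zu by (simp add: F0 landau_sigma_0)
  also have "\<dots> \<le> norm (cnj u * F z)" by (rule complex_Re_le_cmod)
  finally show ?thesis by (simp add: norm_mult u)
qed

text \<open>The image of the boundary circle misses the target disk. Hence the disk is covered by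
  two disjoint open sets, the image of the open disk and the complement of the image of the closed
  one. By connectedness it lies in the former, which contains 0.\<close>

lemma contains_schlicht_disk_if_boundary:
  assumes cont: "continuous_on (cball 0 \<rho>) F" and inj: "inj_on F (ball 0 \<rho>)"
    and F0: "F 0 = 0" and \<rho>: "\<rho> > 0" and \<sigma>: "\<sigma> > 0"
    and boundary: "\<And>z. norm z = \<rho> \<Longrightarrow> \<sigma> \<le> norm (F z)"
  shows "contains_schlicht_disk F \<rho> 0 \<sigma>"
proof -
  have contb: "continuous_on (ball 0 \<rho>) F"
    using cont continuous_on_subset by force
  let ?U = "F ` ball 0 \<rho>" and ?V = "- F ` cball 0 \<rho>"
  have "open ?U"
    using invariance_of_domain[OF contb _ inj] by simp
  moreover have "open ?V"
    using compact_continuous_image[OF cont] compact_imp_closed by (auto intro: open_Compl)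
  moreover have "F z \<in> ?U" if "norm z \<le> \<rho>" "norm (F z) < \<sigma>" for z
  proof -
    have "norm z \<noteq> \<rho>" using boundary[of z] that by auto
    then show ?thesis using that by auto
  qed
  then have cover: "ball 0 \<sigma> \<subseteq> ?U \<union> ?V" by auto
  moreover have "?U \<inter> ?V \<inter> ball 0 \<sigma> = {}"
    using image_mono[OF ball_subset_cball, of F 0 \<rho>] by blast
  ultimately have "?U \<inter> ball 0 \<sigma> = {} \<or> ?V \<inter> ball 0 \<sigma> = {}"
    using connectedD[OF connected_ball[of 0 \<sigma>], of ?U ?V] by blast
  moreover have "0 \<in> ?U \<inter> ball 0 \<sigma>" using F0 \<rho> \<sigma> by force
  ultimately have "?V \<inter> ball 0 \<sigma> = {}" by blast
  then have sub: "ball 0 \<sigma> \<subseteq> F ` ball 0 \<rho>"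
    using cover by blast
  \<comment> \<open>By invariance of domain the inverse is continuous, so it carries the target disk
    to an open connected region.\<close>
  obtain g where g: "homeomorphism (ball 0 \<rho>) (F ` ball 0 \<rho>) F g"
    using invariance_of_domain_homeomorphism[OF open_ball contb order_refl inj] by blast
  let ?\<Omega> = "g ` ball 0 \<sigma>"
  have contg: "continuous_on (ball 0 \<sigma>) g"
    using homeomorphism_cont2[OF g] sub continuous_on_subset by blast
  have Fg: "F (g w) = w" if "w \<in> ball 0 \<sigma>" for w
    using homeomorphism_apply2[OF g] sub that by blast
  have \<Omega>: "?\<Omega> \<subseteq> ball 0 \<rho>"
    using homeomorphism_image2[OF g] sub by blast
  have "open ?\<Omega>"
    using invariance_of_domain[OF contg open_ball] Fg by (metis inj_on_inverseI)
  moreover have "connected ?\<Omega>"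
    by (intro connected_continuous_image contg connected_ball)
  moreover have "F ` ?\<Omega> = ball 0 \<sigma>"
    using Fg by (force simp: image_image)
  ultimately show ?thesis
    unfolding contains_schlicht_disk_def using \<Omega> \<sigma> inj
    by (intro conjI exI[of _ ?\<Omega>]) (auto intro: inj_on_subset)
qed

section \<open>The extremal function and sharpness\<close>

text \<open>The analytic coefficients of \<open>extremal_fun\<close>. The one for k = 0 is given in
  closed form, so that it serves as the primitive that evaluates the contour integral.\<close>

definition extremal_coeff :: "(nat \<Rightarrow> real) \<Rightarrow> nat \<Rightarrow> complex \<Rightarrow> complex" where
  "extremal_coeff \<Lambda> k z =
     (if k = 0 then of_real ((\<Lambda> 0)\<^sup>2) * z + of_real ((\<Lambda> 0) ^ 3 - \<Lambda> 0) * Ln (1 - z / of_real (\<Lambda> 0))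
      else - of_real (\<Lambda> k) * z)"

text \<open>Keeps the argument of \<open>Ln\<close> away from its branch cut.\<close>

lemma Re_one_minus_divide_pos:
  assumes "L > 1" "norm z < 1"
  shows "0 < Re (1 - z / complex_of_real L)"
proof -
  have "Re z < L" using complex_Re_le_cmod[of z] assms by linarith
  then show ?thesis using assms(1) by simp
qed

lemma extremal_coeff_0_derivative:
  assumes L: "\<Lambda> 0 > 1" and z: "norm z < 1"
  shows "(extremal_coeff \<Lambda> 0 has_field_derivative
           of_real (\<Lambda> 0) * ((1 / of_real (\<Lambda> 0) - z) / (1 - z / of_real (\<Lambda> 0)))) (at z)"
proof -
  define l where "l = complex_of_real (\<Lambda> 0)"
  have pos: "0 < Re (1 - z / l)" using Re_one_minus_divide_pos[OF L z] by (simp add: l_def)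
  have nz: "1 - z / l \<noteq> 0" using pos by (metis less_irrefl zero_complex.sel(1))
  have l0: "l \<noteq> 0" using L by (simp add: l_def)
  have "((\<lambda>z. Ln (1 - z / l)) has_field_derivative (- (1 / l)) / (1 - z / l)) (at z)"
    using pos l0 by (auto intro!: derivative_eq_intros simp: complex_nonpos_Reals_iff divide_inverse)
  then have "((\<lambda>z. l\<^sup>2 * z + (l ^ 3 - l) * Ln (1 - z / l)) has_field_derivative
      l\<^sup>2 + (l ^ 3 - l) * ((- (1 / l)) / (1 - z / l))) (at z)"
    by (intro DERIV_add DERIV_cmult) (auto intro!: derivative_eq_intros)
  moreover have "l\<^sup>2 + (l ^ 3 - l) * ((- (1 / l)) / (1 - z / l)) = l * ((1 / l - z) / (1 - z / l))"
  proof -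
    have "(l\<^sup>2 + (l ^ 3 - l) * ((- (1 / l)) / (1 - z / l))) * (1 - z / l) = l * (1 / l - z)"
      using nz l0 by (simp add: distrib_right) (simp add: field_simps power2_eq_square power3_eq_cube)
    then show ?thesis using nz by (simp add: eq_divide_eq)
  qed
  moreover have "extremal_coeff \<Lambda> 0 = (\<lambda>z. l\<^sup>2 * z + (l ^ 3 - l) * Ln (1 - z / l))"
    by (simp add: extremal_coeff_def l_def fun_eq_iff)
  ultimately show ?thesis by (simp add: l_def)
qed

lemma extremal_fun_eq:
  assumes "\<Lambda> 0 > 1" and z: "norm z < 1"
  shows "extremal_fun p \<Lambda> z =
    of_real ((\<Lambda> 0)\<^sup>2) * z - (\<Sum>k\<in>{1..<p}. of_real (\<Lambda> k) * cnj z ^ k * z)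
    + of_real ((\<Lambda> 0) ^ 3 - \<Lambda> 0) * Ln (1 - z / of_real (\<Lambda> 0))"
proof -
  let ?h = "\<lambda>\<zeta>. (1 / of_real (\<Lambda> 0) - \<zeta>) / (1 - \<zeta> / of_real (\<Lambda> 0))"
  \<comment> \<open>The division removes the factor \<open>\<Lambda> 0\<close> that stands outside
    the integral; \<open>?H\<close> vanishes at 0.\<close>
  let ?H = "\<lambda>\<zeta>. extremal_coeff \<Lambda> 0 \<zeta> / of_real (\<Lambda> 0)"
  have "(?h has_contour_integral ?H (pathfinish (linepath 0 z)) - ?H (pathstart (linepath 0 z))) (linepath 0 z)"
  proof (rule contour_integral_primitive[of "ball 0 1"])
    fix w :: complex assume "w \<in> ball 0 1"
    then have "(?H has_field_derivative of_real (\<Lambda> 0) * ?h w / of_real (\<Lambda> 0)) (at w)"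
      using extremal_coeff_0_derivative[of \<Lambda> w] assms by (intro DERIV_cdivide) auto
    then show "(?H has_field_derivative ?h w) (at w within ball 0 1)"
      using assms(1) by (simp add: has_field_derivative_at_within)
  next
    show "path_image (linepath 0 z) \<subseteq> ball 0 1"
      using z closed_segment_subset[of 0 "ball 0 1" z] by simp
  qed (rule valid_path_linepath)
  then have "contour_integral (linepath 0 z) ?h = ?H z - ?H 0"
    by (simp add: contour_integral_unique)
  also have "\<dots> = ?H z" by (simp add: extremal_coeff_def)
  finally show ?thesis
    using assms(1) by (simp add: extremal_fun_def extremal_coeff_def)
qed

lemma extremal_fun_eq_sum:
  assumes "p \<ge> 1" "\<Lambda> 0 > 1" "norm z < 1"
  shows "extremal_fun p \<Lambda> z = (\<Sum>k<p. cnj z ^ k * extremal_coeff \<Lambda> k z)"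
proof -
  have split: "{..<p} = insert 0 {1..<p}" using assms(1) by auto
  have "(\<Sum>k\<in>{1..<p}. cnj z ^ k * extremal_coeff \<Lambda> k z) = - (\<Sum>k\<in>{1..<p}. of_real (\<Lambda> k) * cnj z ^ k * z)"
    by (auto simp: extremal_coeff_def sum_negf[symmetric] intro!: sum.cong)
  then show ?thesis
    unfolding extremal_fun_eq[of \<Lambda>, OF assms(2,3)] split
    by (subst sum.insert) (auto simp: extremal_coeff_def)
qed

lemma landau_hyps_extremal:
  assumes p: "p \<ge> 1" and L: "\<Lambda> 0 > 1" and nonneg: "\<forall>k\<in>{1..<p}. \<Lambda> k \<ge> 0"
  shows "landau_hyps p \<Lambda> (extremal_coeff \<Lambda>) (extremal_fun p \<Lambda>)"
proof -
  have der: "(extremal_coeff \<Lambda> k has_field_derivative - of_real (\<Lambda> k)) (at z)" if "k \<noteq> 0" for k z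
    using that unfolding extremal_coeff_def by (auto intro!: derivative_eq_intros)
  have hol: "extremal_coeff \<Lambda> k holomorphic_on ball 0 1" for k
  proof (cases "k = 0")
    case True
    show ?thesis
      unfolding True using extremal_coeff_0_derivative[of \<Lambda>, OF L]
      by (intro holomorphic_on_open[THEN iffD2]) (simp, blast intro: mem_ball_0[THEN iffD1])
  next
    case False
    then show ?thesis
      using der by (intro holomorphic_on_open[THEN iffD2]) auto
  qed
  have deriv0: "deriv (extremal_coeff \<Lambda> 0) z =
      of_real (\<Lambda> 0) * ((1 / of_real (\<Lambda> 0) - z) / (1 - z / of_real (\<Lambda> 0)))" if "norm z < 1" for z
    using extremal_coeff_0_derivative[of \<Lambda>, OF L that] by (rule DERIV_imp_deriv)
  have bound0: "norm (deriv (extremal_coeff \<Lambda> 0) z) < \<Lambda> 0" if "norm z < 1" for z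
  proof -
    \<comment> \<open>Up to sign, the derivative of the coefficient for k = 0 is
      \<open>\<Lambda> 0\<close> times this disk automorphism, which gives the strict bound.\<close>
    have "norm (Moebius_function 0 (of_real (1 / \<Lambda> 0)) z) < 1"
      by (rule Moebius_function_norm_lt_1[OF _ that]) (use L in \<open>simp add: norm_divide\<close>)
    then have "norm ((1 / of_real (\<Lambda> 0) - z) / (1 - z / of_real (\<Lambda> 0))) < 1"
      by (simp add: Moebius_function_simple norm_divide norm_minus_commute)
    then show ?thesis using L unfolding deriv0[OF that] norm_mult by simp
  qed
  have "polyanalytic_on p (extremal_fun p \<Lambda>) (ball 0 1)"
    by (rule polyanalytic_on_sum[of _ _ "extremal_coeff \<Lambda>"]) (use hol extremal_fun_eq_sum p L in auto)
  moreover have "norm (deriv (extremal_coeff \<Lambda> k) z) \<le> \<Lambda> k" if "k \<in> {1..<p}" for k z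
    using DERIV_imp_deriv[OF der[of k z]] that nonneg by simp
  moreover have "deriv (extremal_coeff \<Lambda> 0) 0 = 1" using deriv0[of 0] L by simp
  moreover have "extremal_coeff \<Lambda> k 0 = 0" for k by (simp add: extremal_coeff_def)
  moreover have "extremal_coeff \<Lambda> k analytic_on ball 0 1" for k
    using hol by (simp add: analytic_on_open)
  ultimately show ?thesis
    unfolding landau_hyps_def Ball_def mem_ball_0
    using bound0 extremal_fun_eq_sum[of p \<Lambda>, OF p L] by blast
qed

lemma extremal_fun_of_real:
  assumes L: "\<Lambda> 0 > 1" and x: "0 \<le> x" "x < 1"
  shows "extremal_fun p \<Lambda> (of_real x) = of_real (landau_sigma p \<Lambda> x)"
proof -
  have "1 - x / \<Lambda> 0 > 0" using assms by (simp add: field_simps)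
  then have "Ln (1 - of_real x / of_real (\<Lambda> 0)) = complex_of_real (ln (1 - x / \<Lambda> 0))"
    using Ln_of_real[of "1 - x / \<Lambda> 0"] by simp
  then show ?thesis
    using extremal_fun_eq[of \<Lambda> "of_real x" p] assms
    by (simp add: landau_sigma_def algebra_simps)
qed

text \<open>On the real segment the function is \<open>landau_sigma\<close>, which increases
  strictly up to \<open>\<rho>\<close> and decreases strictly after it, so some value is taken on
  both sides of \<open>\<rho>\<close>.\<close>

lemma extremal_not_inj_on:
  assumes L: "\<Lambda> 0 > 1" and nonneg: "\<forall>k\<in>{1..<p}. \<Lambda> k \<ge> 0"
    and root: "is_radius_root p \<Lambda> \<rho>" and r: "\<rho> < r" "r \<le> 1"
  shows "\<not> inj_on (extremal_fun p \<Lambda>) (ball 0 r)"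
proof
  assume inj: "inj_on (extremal_fun p \<Lambda>) (ball 0 r)"
  have \<rho>: "0 < \<rho>" "radius_fun p \<Lambda> \<rho> = 0" using root by (auto simp: is_radius_root_iff)
  \<comment> \<open>The midpoint stays below 1 even when r = 1.\<close>
  define s where "s = (\<rho> + r) / 2"
  have s: "\<rho> < s" "s < r" "s < 1" using r by (auto simp: s_def)
  let ?G = "landau_sigma p \<Lambda>"
  have DG: "(?G has_real_derivative radius_fun p \<Lambda> t) (at t)" if "t < 1" for t
    using landau_sigma_derivative L that by blast
  have cont: "continuous_on {0..s} ?G"
    by (rule DERIV_continuous_on[of _ _ "radius_fun p \<Lambda>"])
      (use s in \<open>auto intro!: has_field_derivative_at_within[OF DG]\<close>)
  have up: "?G 0 < ?G \<rho>"
  proof (rule DERIV_pos_imp_increasing_open[OF \<rho>(1)])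
    fix t assume "0 < t" "t < \<rho>"
    then show "\<exists>y. (?G has_real_derivative y) (at t) \<and> 0 < y"
      using radius_fun_strict_antimono[OF L nonneg, of t \<rho>] \<rho> r
      by (intro exI[of _ "radius_fun p \<Lambda> t"] conjI DG) auto
  qed (use cont s in \<open>auto intro: continuous_on_subset\<close>)
  have down: "?G s < ?G \<rho>"
  proof (rule DERIV_neg_imp_decreasing_open[OF s(1)])
    fix t assume "\<rho> < t" "t < s"
    then show "\<exists>y. (?G has_real_derivative y) (at t) \<and> y < 0"
      using radius_fun_strict_antimono[OF L nonneg, of \<rho> t] \<rho> s
      by (intro exI[of _ "radius_fun p \<Lambda> t"] conjI DG) auto
  qed (use cont \<rho> in \<open>auto intro: continuous_on_subset\<close>)
  \<comment> \<open>The larger endpoint value is attained on both [0, \<open>\<rho>\<close>] and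
    [\<open>\<rho>\<close>, s]. It lies below the value at \<open>\<rho>\<close>, the only common
    point, so the two preimages differ.\<close>
  define v where "v = max (?G 0) (?G s)"
  obtain x where x: "0 \<le> x" "x \<le> \<rho>" "?G x = v"
    using IVT'[of ?G 0 v \<rho>] up down \<rho> s continuous_on_subset[OF cont, of "{0..\<rho>}"]
    by (auto simp: v_def)
  obtain y where y: "\<rho> \<le> y" "y \<le> s" "?G y = v"
    using IVT2'[of ?G s v \<rho>] up down \<rho> s continuous_on_subset[OF cont, of "{\<rho>..s}"]
    by (auto simp: v_def)
  have "v < ?G \<rho>" using up down by (simp add: v_def)
  moreover have "y = \<rho>" if "x = y" using that x(2) y(1) by simp
  ultimately have "x \<noteq> y" using y(3) by auto
  have "extremal_fun p \<Lambda> (of_real x) = extremal_fun p \<Lambda> (of_real y)"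
    using extremal_fun_of_real[of \<Lambda>, OF L] x y s \<rho> by simp
  with inj have "complex_of_real x = of_real y"
    by (rule inj_onD) (use x y s \<rho> in auto)
  then show False using \<open>x \<noteq> y\<close> by simp
qed

theorem theorem1:
  fixes p :: nat and \<Lambda> :: "nat \<Rightarrow> real"
  assumes "p \<ge> 1" and "\<Lambda> 0 > 1" and "\<forall>k\<in>{1..<p}. \<Lambda> k \<ge> 0"
  shows "(\<exists>!r. is_radius_root p \<Lambda> r) \<and>
    (\<forall>\<rho>1 \<sigma>1. is_radius_root p \<Lambda> \<rho>1 \<and> \<sigma>1 = landau_sigma p \<Lambda> \<rho>1 \<longrightarrow>
       (\<forall>A F. landau_hyps p \<Lambda> A F \<longrightarrow>
          inj_on F (ball 0 \<rho>1) \<and> contains_schlicht_disk F \<rho>1 0 \<sigma>1) \<and>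
       (\<forall>z\<in>ball 0 1. extremal_fun p \<Lambda> z =
          of_real ((\<Lambda> 0)\<^sup>2) * z - (\<Sum>k\<in>{1..<p}. of_real (\<Lambda> k) * cnj z ^ k * z)
          + of_real ((\<Lambda> 0) ^ 3 - \<Lambda> 0) * Ln (1 - z / of_real (\<Lambda> 0))) \<and>
       (\<exists>A. landau_hyps p \<Lambda> A (extremal_fun p \<Lambda>)) \<and>
       (\<forall>r. \<rho>1 < r \<and> r \<le> 1 \<longrightarrow> \<not> inj_on (extremal_fun p \<Lambda>) (ball 0 r)) \<and>
       (\<forall>R>\<sigma>1. \<not> ball 0 R \<subseteq> extremal_fun p \<Lambda> ` ball 0 \<rho>1))"
proof (rule conjI[OF ex1_radius_root[OF assms(2,3)]], intro allI impI, elim conjE)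
  fix \<rho> \<sigma> assume root: "is_radius_root p \<Lambda> \<rho>" and \<sigma>: "\<sigma> = landau_sigma p \<Lambda> \<rho>"
  have \<rho>: "0 < \<rho>" "\<rho> < 1" "radius_fun p \<Lambda> \<rho> = 0" using root by (auto simp: is_radius_root_iff)
  have pos: "radius_fun p \<Lambda> r > 0" if "0 \<le> r" "r < \<rho>" for r
    using radius_fun_strict_antimono[OF assms(2,3) that] \<rho> by simp
  have inj: "inj_on F (cball 0 \<rho>)" if "landau_hyps p \<Lambda> A F" for A F
    using landau_inj_on_cball[OF assms(1) that \<rho>(2) pos] .
  have "\<sigma> > 0"
  proof -
    have "landau_sigma p \<Lambda> 0 < landau_sigma p \<Lambda> \<rho>"
    proof (rule DERIV_pos_imp_increasing_open[OF \<rho>(1)])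
      show "\<exists>y. (landau_sigma p \<Lambda> has_real_derivative y) (at t) \<and> 0 < y" if "0 < t" "t < \<rho>" for t
        using landau_sigma_derivative[of \<Lambda> t p] assms(2) pos[of t] that \<rho> by auto
      show "continuous_on {0..\<rho>} (landau_sigma p \<Lambda>)"
        using \<rho> assms(2) by (intro DERIV_continuous_on[of _ _ "radius_fun p \<Lambda>"]
            has_field_derivative_at_within[OF landau_sigma_derivative]) auto
    qed
    then show ?thesis by (simp add: \<sigma> landau_sigma_0)
  qed
  note ext = landau_hyps_extremal[of p \<Lambda>, OF assms]
  have main: "inj_on F (ball 0 \<rho>) \<and> contains_schlicht_disk F \<rho> 0 \<sigma>" if "landau_hyps p \<Lambda> A F" for A F
  proof
    show inj': "inj_on F (ball 0 \<rho>)" using inj[OF that] by (rule inj_on_subset) auto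
    show "contains_schlicht_disk F \<rho> 0 \<sigma>"
    proof (rule contains_schlicht_disk_if_boundary[OF _ inj' _ \<rho>(1) \<open>\<sigma> > 0\<close>])
      show "continuous_on (cball 0 \<rho>) F"
        by (rule continuous_on_subset[OF landau_continuous_on[OF that]]) (use \<rho> in auto)
      show "F 0 = 0" using landau_hypsD(2,3)[OF that] by simp
      show "\<sigma> \<le> norm (F z)" if "norm z = \<rho>" for z
        using landau_sigma_le_norm[OF assms(1,2) \<open>landau_hyps p \<Lambda> A F\<close>, of z] that \<rho> \<sigma> by simp
    qed
  qed
  have outside: "\<not> ball 0 R \<subseteq> extremal_fun p \<Lambda> ` ball 0 \<rho>" if "R > \<sigma>" for R
  proof
    assume "ball 0 R \<subseteq> extremal_fun p \<Lambda> ` ball 0 \<rho>"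
    \<comment> \<open>The omitted point is \<open>\<sigma>\<close>, the value at the boundary point
      \<open>\<rho>\<close>; injectivity on the closed disk forbids a second preimage
      inside.\<close>
    moreover have "complex_of_real \<sigma> \<in> ball 0 R" using that \<open>\<sigma> > 0\<close> by simp
    ultimately have "of_real \<sigma> \<in> extremal_fun p \<Lambda> ` ball 0 \<rho>" by blast
    then obtain z where z: "norm z < \<rho>" "extremal_fun p \<Lambda> z = of_real \<sigma>" by auto
    then have "extremal_fun p \<Lambda> z = extremal_fun p \<Lambda> (of_real \<rho>)"
      using extremal_fun_of_real[of \<Lambda> \<rho>] \<rho> assms(2) \<sigma> by simp
    then have "z = of_real \<rho>"
      by (rule inj_onD[OF inj[OF ext]]) (use z(1) \<rho> in auto)
    then show False using z(1) \<rho> by simp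
  qed
  show "(\<forall>A F. landau_hyps p \<Lambda> A F \<longrightarrow>
          inj_on F (ball 0 \<rho>) \<and> contains_schlicht_disk F \<rho> 0 \<sigma>) \<and>
       (\<forall>z\<in>ball 0 1. extremal_fun p \<Lambda> z =
          of_real ((\<Lambda> 0)\<^sup>2) * z - (\<Sum>k\<in>{1..<p}. of_real (\<Lambda> k) * cnj z ^ k * z)
          + of_real ((\<Lambda> 0) ^ 3 - \<Lambda> 0) * Ln (1 - z / of_real (\<Lambda> 0))) \<and>
       (\<exists>A. landau_hyps p \<Lambda> A (extremal_fun p \<Lambda>)) \<and>
       (\<forall>r. \<rho> < r \<and> r \<le> 1 \<longrightarrow> \<not> inj_on (extremal_fun p \<Lambda>) (ball 0 r)) \<and>
       (\<forall>R>\<sigma>. \<not> ball 0 R \<subseteq> extremal_fun p \<Lambda> ` ball 0 \<rho>)"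
  proof (intro conjI allI impI ballI)
    show "inj_on F (ball 0 \<rho>)" "contains_schlicht_disk F \<rho> 0 \<sigma>" if "landau_hyps p \<Lambda> A F" for A F
      using main[OF that] by auto
    show "extremal_fun p \<Lambda> z =
          of_real ((\<Lambda> 0)\<^sup>2) * z - (\<Sum>k\<in>{1..<p}. of_real (\<Lambda> k) * cnj z ^ k * z)
          + of_real ((\<Lambda> 0) ^ 3 - \<Lambda> 0) * Ln (1 - z / of_real (\<Lambda> 0))" if "z \<in> ball 0 1" for z
      using extremal_fun_eq[of \<Lambda> z p] assms(2) that by (simp only: mem_ball_0)
    show "\<exists>A. landau_hyps p \<Lambda> A (extremal_fun p \<Lambda>)" using ext by blast
    show "\<not> inj_on (extremal_fun p \<Lambda>) (ball 0 r)" if "\<rho> < r \<and> r \<le> 1" for r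
      using extremal_not_inj_on[OF assms(2,3) root] that by blast
    show "\<not> ball 0 R \<subseteq> extremal_fun p \<Lambda> ` ball 0 \<rho>" if "\<sigma> < R" for R
      using outside[OF that] .
  qed
qed

end
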